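(* Let $n\ge 1$, let $\alpha>0$ and $\beta,\gamma,\delta\ge 0$ be real numbers, let $S\in\mathbb{R}^{n\times n}$, and let $$A=\begin{bmatrix}0 & I\\ -\alpha S-\delta I & -\beta S-\gamma I\end{bmatrix}\in\mathbb{R}^{2n\times 2n}.$$ Assume that there exist an orthogonal matrix $Q\in\mathbb{R}^{n\times n}$ and a diagonal matrix $D=\operatorname{diag}\{\lambda_1,\dots,\lambda_n\}\in\mathbb{R}^{n\times n}$ such that $S=QDQ'$. Then, for every $t>0$, $$\mathrm{e}^{tA}=\begin{bmatrix}Q&0\\0&Q\end{bmatrix}P\begin{bmatrix}\mathrm{e}^{tG_1}&0&\cdots&0\\0&\mathrm{e}^{tG_2}&\cdots&0\\ \vdots&\vdots&\ddots&0\\0&0&\cdots&\mathrm{e}^{tG_n}\end{bmatrix}P'\begin{bmatrix}Q'&0\\0&Q'\end{bmatrix},$$ where $$G_i=\begin{bmatrix}0&1\\-\alpha\lambda_i-\delta&-\beta\lambda_i-\gamma\end{bmatrix},\qquad 1\le i\le n,$$ and $P\in\mathbb{R}^{2n\times 2n}$ is the permutation matrix with $P_{i,2i-1}=1$ and $P_{i+n,2i}=1$ for $1\le i\le n$, and all other entries equal to $0$.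
   Context: $E'$ denotes the transpose of a matrix $E$; $I$ denotes the identity matrix of the appropriate size; $\mathrm{e}^{M}$ is the matrix exponential. *)

theory Defs
  imports Complex_Main "Jordan_Normal_Form.Jordan_Normal_Form"
begin

text \<open>Entrywise sum of the exponential series of a square matrix; the series converges for
  every square matrix, see \<open>mat_exp_sums\<close> below.\<close>
definition mat_exp :: "real mat \<Rightarrow> real mat" where
  "mat_exp M = mat (dim_row M) (dim_row M)
     (\<lambda>(i, j). \<Sum>k. ((1 / fact k) \<cdot>\<^sub>m (M ^\<^sub>m k)) $$ (i, j))"

lemma norm_bound_pow_mat:
  fixes M :: "real mat"
  assumes M: "M \<in> carrier_mat n n" and b: "norm_bound M b"
  shows "norm_bound (M ^\<^sub>m k) ((\<bar>b\<bar> * real n + 1) ^ k)"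
proof (induction k)
  case 0
  show ?case using M by (auto simp: norm_bound_def)
next
  case (Suc k)
  let ?c = "\<bar>b\<bar> * real n + 1"
  have "norm_bound (M ^\<^sub>m k * M) (?c ^ k * \<bar>b\<bar> * of_nat n)"
  proof (rule norm_bound_mult)
    show "M ^\<^sub>m k \<in> carrier_mat n n" using M by simp
    show "norm_bound M \<bar>b\<bar>" using b by (fastforce simp: norm_bound_def)
  qed (use M Suc.IH in auto)
  moreover have "?c ^ k * \<bar>b\<bar> * real n \<le> ?c ^ Suc k"
    by (simp add: algebra_simps)
  ultimately show ?case
    unfolding norm_bound_def pow_mat.simps by (meson order_trans)
qed

lemma mat_exp_sums:
  assumes M: "M \<in> carrier_mat n n" and ij: "i < n" "j < n"
  shows "(\<lambda>k. ((1 / fact k) \<cdot>\<^sub>m (M ^\<^sub>m k)) $$ (i, j)) sums (mat_exp M $$ (i, j))"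
proof -
  obtain b where b: "norm_bound M b" using norm_bound_max by blast
  let ?c = "\<bar>b\<bar> * real n + 1"
  have Mk: "M ^\<^sub>m k \<in> carrier_mat n n" for k using M by simp
  have le: "norm (((1 / fact k) \<cdot>\<^sub>m (M ^\<^sub>m k)) $$ (i, j)) \<le> inverse (fact k) * ?c ^ k" for k
  proof -
    have "norm ((M ^\<^sub>m k) $$ (i, j)) \<le> ?c ^ k"
      using norm_bound_pow_mat[OF M b, of k] Mk[of k] ij
      by (metis norm_bound_def carrier_matD)
    moreover have "((1 / fact k) \<cdot>\<^sub>m (M ^\<^sub>m k)) $$ (i, j) = (1 / fact k) * (M ^\<^sub>m k) $$ (i, j)"
      using carrier_matD[OF Mk[of k]] ij by (intro index_smult_mat(1)) simp_all
    ultimately show ?thesis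
      by (simp only:) (simp add: abs_mult field_simps)
  qed
  have "summable (\<lambda>k. ((1 / fact k) \<cdot>\<^sub>m (M ^\<^sub>m k)) $$ (i, j))"
    by (rule summable_comparison_test'[OF summable_exp[of ?c], of 0]) (rule le)
  moreover have "mat_exp M $$ (i, j) = (\<Sum>k. ((1 / fact k) \<cdot>\<^sub>m (M ^\<^sub>m k)) $$ (i, j))"
    using M ij by (simp add: mat_exp_def)
  ultimately show ?thesis by (simp add: summable_sums)
qed

text \<open>\<open>orthogonal_mat\<close> of the library only asks for nonzero pairwise orthogonal columns, which
  need not have norm one.\<close>
definition orthogonal_matrix_real :: "nat \<Rightarrow> real mat \<Rightarrow> bool" where
  "orthogonal_matrix_real n Q \<longleftrightarrow>
     Q \<in> carrier_mat n n \<and> Q\<^sup>T * Q = 1\<^sub>m n \<and> Q * Q\<^sup>T = 1\<^sub>m n"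

definition A_mat :: "nat \<Rightarrow> real \<Rightarrow> real \<Rightarrow> real \<Rightarrow> real \<Rightarrow> real mat \<Rightarrow> real mat" where
  "A_mat n \<alpha> \<beta> \<gamma> \<delta> S = four_block_mat
     (0\<^sub>m n n)                                (1\<^sub>m n)
     ((- \<alpha>) \<cdot>\<^sub>m S - \<delta> \<cdot>\<^sub>m 1\<^sub>m n)   ((- \<beta>) \<cdot>\<^sub>m S - \<gamma> \<cdot>\<^sub>m 1\<^sub>m n)"

definition G_mat :: "real \<Rightarrow> real \<Rightarrow> real \<Rightarrow> real \<Rightarrow> real \<Rightarrow> real mat" where
  "G_mat \<alpha> \<beta> \<gamma> \<delta> l = mat_of_rows_list 2
     [[0, 1],
      [- \<alpha> * l - \<delta>, - \<beta> * l - \<gamma>]]"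

text \<open>Matrix indices start at 0 here. In 1-based indexing the ones are at the positions
  \<open>(i, 2i-1)\<close> and \<open>(i+n, 2i)\<close> for \<open>1 \<le> i \<le> n\<close>.\<close>
definition P_mat :: "nat \<Rightarrow> real mat" where
  "P_mat n = mat (2 * n) (2 * n) (\<lambda>(r, c).
     if \<exists>i<n. (r = i \<and> c = 2 * i) \<or> (r = i + n \<and> c = 2 * i + 1) then 1 else 0)"

end

theory Submission
  imports Defs
begin

text \<open>The matrix exponential commutes with similarity and acts blockwise on block diagonal
  matrices, so it is enough to see that \<open>A\<close> is similar to the block diagonal matrix of the
  \<open>G\<^sub>i\<close>. Conjugation by \<open>Q\<close> in both coordinates turns the four blocks of \<open>A\<close> into diagonal
  matrices, and the permutation \<open>P\<close> then pairs the coordinates \<open>i\<close> and \<open>n + i\<close>.\<close>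

section \<open>Exponentials of similar and of block diagonal matrices\<close>

lemma mat_exp_carrier [simp]: "M \<in> carrier_mat n n \<Longrightarrow> mat_exp M \<in> carrier_mat n n"
  by (simp add: mat_exp_def)

text \<open>Limits of real series are unique. Exponentials can thus be identified one entry at a
  time, without a topology on matrices.\<close>

lemma mat_exp_eqI:
  assumes "M \<in> carrier_mat n n" "E \<in> carrier_mat n n"
    and "\<And>i j. i < n \<Longrightarrow> j < n \<Longrightarrow> (\<lambda>k. (1 / fact k) * (M ^\<^sub>m k) $$ (i, j)) sums (E $$ (i, j))"
  shows "mat_exp M = E"
proof (rule eq_matI)
  fix i j assume "i < dim_row E" "j < dim_col E"
  hence ij: "i < n" "j < n" using assms(2) by auto
  have "(\<lambda>k. ((1 / fact k) \<cdot>\<^sub>m (M ^\<^sub>m k)) $$ (i, j)) sums (E $$ (i, j))"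
    using assms(3)[OF ij] assms(1) ij by simp
  thus "mat_exp M $$ (i, j) = E $$ (i, j)"
    using mat_exp_sums[OF assms(1) ij] sums_unique2 by blast
qed (use assms in \<open>auto simp: mat_exp_def\<close>)

lemma mat_exp_sums_entry:
  assumes "M \<in> carrier_mat n n" "i < n" "j < n"
  shows "(\<lambda>k. (1 / fact k) * (M ^\<^sub>m k) $$ (i, j)) sums (mat_exp M $$ (i, j))"
  using mat_exp_sums[OF assms] assms by simp

lemma index_mult_mult_mat:
  assumes "U \<in> carrier_mat n n" "X \<in> carrier_mat n n" "V \<in> carrier_mat n n" "i < n" "j < n"
  shows "(U * X * V) $$ (i, j) = (\<Sum>b<n. (\<Sum>a<n. U $$ (i, a) * X $$ (a, b)) * V $$ (b, j))"
  using assms by (simp add: scalar_prod_def lessThan_atLeast0 del: assoc_mult_mat)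

text \<open>The powers satisfy \<open>A ^\<^sub>m k = U * B ^\<^sub>m k * V\<close>. Each entry of
  the right-hand side is a finite linear combination of entries of \<open>B ^\<^sub>m k\<close>,
  with coefficients that do not depend on \<open>k\<close>, so the series can be summed inside
  it.\<close>

lemma mat_exp_similar:
  assumes "similar_mat_wit A B U V"
  shows "mat_exp A = U * mat_exp B * V"
proof -
  define n where "n = dim_row A"
  note wit = similar_mat_witD[OF n_def assms]
  show ?thesis
  proof (rule mat_exp_eqI[of _ n])
    fix i j assume ij: "i < n" "j < n"
    have "(\<lambda>k. \<Sum>b<n. (\<Sum>a<n. U $$ (i, a) * ((1 / fact k) * (B ^\<^sub>m k) $$ (a, b))) * V $$ (b, j))
      sums (\<Sum>b<n. (\<Sum>a<n. U $$ (i, a) * mat_exp B $$ (a, b)) * V $$ (b, j))"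
      by (intro sums_sum sums_mult sums_mult2 mat_exp_sums_entry[OF wit(5)]) auto
    also have "(\<lambda>k. \<Sum>b<n. (\<Sum>a<n. U $$ (i, a) * ((1 / fact k) * (B ^\<^sub>m k) $$ (a, b))) * V $$ (b, j))
      = (\<lambda>k. (1 / fact k) * (U * B ^\<^sub>m k * V) $$ (i, j))"
      using wit(5-7) ij
      by (simp add: index_mult_mult_mat[of _ n] sum_distrib_left sum_distrib_right mult_ac
          del: index_mult_mat)
    also have "(\<lambda>k. (1 / fact k) * (U * B ^\<^sub>m k * V) $$ (i, j))
      = (\<lambda>k. (1 / fact k) * (A ^\<^sub>m k) $$ (i, j))"
      by (simp only: similar_mat_wit_pow_id[OF assms])
    also have "(\<Sum>b<n. (\<Sum>a<n. U $$ (i, a) * mat_exp B $$ (a, b)) * V $$ (b, j))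
      = (U * mat_exp B * V) $$ (i, j)"
      using wit(5-7) ij by (simp add: index_mult_mult_mat[of _ n] del: index_mult_mat)
    finally show "(\<lambda>k. (1 / fact k) * (A ^\<^sub>m k) $$ (i, j)) sums ((U * mat_exp B * V) $$ (i, j))" .
  qed (use wit(4-7) in auto)
qed

text \<open>Powers act on the two diagonal blocks separately, and every term of the series vanishes
  in the off-diagonal blocks.\<close>

lemma mat_exp_four_block_diag:
  assumes "A \<in> carrier_mat n n" "B \<in> carrier_mat m m"
  shows "mat_exp (four_block_mat A (0\<^sub>m n m) (0\<^sub>m m n) B) =
    four_block_mat (mat_exp A) (0\<^sub>m n m) (0\<^sub>m m n) (mat_exp B)"
proof (rule mat_exp_eqI[of _ "n + m"])
  fix i j assume "i < n + m" "j < n + m"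
  moreover have "mat_exp A \<in> carrier_mat n n" "mat_exp B \<in> carrier_mat m m"
    "\<And>k. dim_row (A ^\<^sub>m k) = n" "\<And>k. dim_col (A ^\<^sub>m k) = n"
    "\<And>k. dim_row (B ^\<^sub>m k) = m" "\<And>k. dim_col (B ^\<^sub>m k) = m"
    using assms carrier_matD[OF pow_carrier_mat[OF assms(1)]]
      carrier_matD[OF pow_carrier_mat[OF assms(2)]] by simp_all
  ultimately show "(\<lambda>k. (1 / fact k) * (four_block_mat A (0\<^sub>m n m) (0\<^sub>m m n) B ^\<^sub>m k) $$ (i, j)) sums
    (four_block_mat (mat_exp A) (0\<^sub>m n m) (0\<^sub>m m n) (mat_exp B) $$ (i, j))"
    using mat_exp_sums_entry[OF assms(1), of i j] mat_exp_sums_entry[OF assms(2), of "i - n" "j - n"]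
    by (auto simp: pow_four_block_mat[OF assms])
qed (use assms in auto)

lemma mat_exp_diag_block:
  assumes "\<forall>M \<in> set Ms. square_mat M"
  shows "mat_exp (diag_block_mat Ms) = diag_block_mat (map mat_exp Ms)"
  using assms
proof (induction Ms)
  case Nil
  show ?case by (auto simp: mat_exp_def)
next
  case (Cons M Ms)
  have sq: "square_mat M" "square_mat (diag_block_mat Ms)"
    using Cons.prems diag_block_mat_square[of Ms] by auto
  have carr: "M \<in> carrier_mat (dim_row M) (dim_row M)"
    "diag_block_mat Ms \<in> carrier_mat (dim_row (diag_block_mat Ms)) (dim_row (diag_block_mat Ms))"
    using sq by auto
  have IH: "diag_block_mat (map mat_exp Ms) = mat_exp (diag_block_mat Ms)"
    using Cons by simp
  \<comment> \<open>\<open>mat_exp\<close> takes both dimensions from \<open>dim_row\<close>;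
    squareness of \<open>M\<close> and of the tail makes the zero blocks keep their shape.\<close>
  have dims: "dim_row (mat_exp X) = dim_row X" "dim_col (mat_exp X) = dim_row X" for X
    by (simp_all add: mat_exp_def)
  show ?case
    using mat_exp_four_block_diag[OF carr] sq
    by (simp add: Let_def IH dims)
qed

section \<open>Entries of block diagonal matrices and similarity by a permutation\<close>

lemma smult_diag_block_mat:
  fixes a :: "'a :: semiring_0"
  shows "a \<cdot>\<^sub>m diag_block_mat Ms = diag_block_mat (map ((\<cdot>\<^sub>m) a) Ms)"
proof (induction Ms)
  case (Cons M Ms)
  show ?case
    unfolding diag_block_mat.simps Let_def list.map Cons.IH[symmetric]
    by (subst smult_four_block_mat) auto
qed auto

lemma sum_list_constant_on:
  "\<forall>x \<in> set xs. f x = c \<Longrightarrow> (\<Sum>x\<leftarrow>xs. f x) = length xs * (c :: nat)"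
  by (induction xs) auto

lemma index_diag_block_mat_uniform:
  assumes "\<forall>M \<in> set Ms. M \<in> carrier_mat m m" "i < length Ms * m" "j < length Ms * m"
  shows "diag_block_mat Ms $$ (i, j) =
    (if i div m = j div m then (Ms ! (i div m)) $$ (i mod m, j mod m) else 0)"
  using assms
proof (induction Ms arbitrary: i j)
  case (Cons M Ms)
  \<comment> \<open>For \<open>m = 0\<close> no index \<open>i\<close> would be in range, so
    division by \<open>m\<close> is meaningful below.\<close>
  have m: "m > 0" using Cons.prems(2) by (cases m) auto
  have M: "dim_row M = m" "dim_col M = m" using Cons.prems(1) by auto
  have dims: "dim_row (diag_block_mat Ms) = length Ms * m"
    "dim_col (diag_block_mat Ms) = length Ms * m"
    unfolding dim_diag_block_mat
    by (rule sum_list_constant_on; use Cons.prems(1) in auto)+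
  \<comment> \<open>Dropping the first block shifts an index by \<open>m\<close>: the block number
    falls by one and the position within the block stays.\<close>
  have step: "i div m = Suc ((i - m) div m)" "i mod m = (i - m) mod m" if "\<not> i < m" for i
    using that m by (auto simp: le_div_geq le_mod_geq)
  show ?case
    using Cons.IH[of "i - m" "j - m"] Cons.prems
    by (cases "i < m"; cases "j < m") (auto simp: Let_def M dims step)
qed simp

text \<open>Row \<open>i\<close> of \<open>P\<close> is the unit vector with its one at \<sigma>
  \<open>i\<close>, so \<open>P * X * P\<^sup>T\<close> reads off the entry of \<open>X\<close> at
  \<sigma> \<open>i\<close>, \<sigma> \<open>j\<close>. Injectivity of \<sigma> makes the rows
  orthonormal.\<close>

lemma similar_mat_wit_permutation:
  fixes X :: "'a :: field mat"
  assumes bij: "bij_betw \<sigma> {..<N} {..<N}" and X: "X \<in> carrier_mat N N"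
    and P: "P = mat N N (\<lambda>(r, c). if c = \<sigma> r then 1 else 0)"
  shows "similar_mat_wit (mat N N (\<lambda>(i, j). X $$ (\<sigma> i, \<sigma> j))) X P P\<^sup>T"
proof -
  have lt: "\<sigma> i < N" if "i < N" for i using bij that by (auto simp: bij_betw_def)
  have inj: "\<sigma> i = \<sigma> j \<longleftrightarrow> i = j" if "i < N" "j < N" for i j
    using bij that by (auto simp: bij_betw_def inj_on_def)
  have PP: "P * P\<^sup>T = 1\<^sub>m N"
  proof (rule eq_matI)
    fix i j assume "i < dim_row (1\<^sub>m N)" "j < dim_col (1\<^sub>m N)"
    hence ij: "i < N" "j < N" by auto
    hence "(P * P\<^sup>T) $$ (i, j) =
      (\<Sum>c = 0..<N. (if c = \<sigma> i then 1 else 0) * (if c = \<sigma> j then 1 else 0))"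
      by (simp add: P scalar_prod_def)
    also have "\<dots> = (\<Sum>c = 0..<N. if c = \<sigma> i then (if c = \<sigma> j then 1 else 0) else 0)"
      by (rule sum.cong) auto
    also have "\<dots> = 1\<^sub>m N $$ (i, j)" using ij lt inj by simp
    finally show "(P * P\<^sup>T) $$ (i, j) = 1\<^sub>m N $$ (i, j)" .
  qed (auto simp: P)
  have carr: "P \<in> carrier_mat N N" "P\<^sup>T \<in> carrier_mat N N" by (auto simp: P)
  have "mat N N (\<lambda>(i, j). X $$ (\<sigma> i, \<sigma> j)) = P * X * P\<^sup>T" (is "?L = ?R")
  proof (rule eq_matI)
    fix i j assume "i < dim_row ?R" "j < dim_col ?R"
    hence ij: "i < N" "j < N" by (auto simp: P)
    have "?R $$ (i, j) = (\<Sum>b<N. (\<Sum>a<N. (if a = \<sigma> i then 1 else 0) * X $$ (a, b)) *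
        (if b = \<sigma> j then 1 else 0))"
      unfolding index_mult_mult_mat[OF carr(1) X carr(2) ij] using ij by (auto simp: P)
    also have "\<dots> = X $$ (\<sigma> i, \<sigma> j)"
      using ij lt
      by (simp add: if_distrib[of "\<lambda>x. x * _"] if_distrib[of "(*) _"] cong: if_cong)
    finally show "?L $$ (i, j) = ?R $$ (i, j)" using ij by simp
  qed (auto simp: P)
  \<comment> \<open>For square matrices over a field the right inverse \<open>PP\<close> is also a
    left inverse.\<close>
  thus ?thesis
    using similar_mat_witI[OF PP mat_mult_left_right_inverse[OF carr PP]] carr X by simp
qed

text \<open>The perfect shuffle: the coordinates \<open>i\<close> and \<open>n + i\<close> move to
  the adjacent places \<open>2 * i\<close> and \<open>2 * i + 1\<close>, which the block of index
  \<open>i\<close> occupies.\<close>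

definition interleave :: "nat \<Rightarrow> nat \<Rightarrow> nat" where
  "interleave n r = (if r < n then 2 * r else 2 * (r - n) + 1)"

lemma bij_betw_interleave: "bij_betw (interleave n) {..<2 * n} {..<2 * n}"
proof (rule bij_betwI[where g = "\<lambda>c. if even c then c div 2 else c div 2 + n"])
qed (auto simp: interleave_def elim!: evenE oddE)

text \<open>Brings \<open>P_mat\<close> into the form that
  \<open>similar_mat_wit_permutation\<close> expects. The index \<open>i\<close> in its definition
  is forced: it is \<open>r\<close> in the upper half and \<open>r - n\<close> in the lower
  half.\<close>

lemma P_mat_interleave:
  "P_mat n = mat (2 * n) (2 * n) (\<lambda>(r, c). if c = interleave n r then 1 else 0)"
proof -
  have "(\<exists>i<n. (r = i \<and> c = 2 * i) \<or> (r = i + n \<and> c = 2 * i + 1)) \<longleftrightarrow> c = interleave n r"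
    if "r < 2 * n" for r c
    using that by (auto simp: interleave_def intro: exI[of _ "r - n"])
  thus ?thesis by (auto simp: P_mat_def)
qed

section \<open>Reduction of \<open>A_mat\<close> to the blocks \<open>G_mat\<close>\<close>

lemma orthogonal_conj_affine:
  fixes D Q :: "real mat"
  assumes Q: "orthogonal_matrix_real n Q" and D: "D \<in> carrier_mat n n"
  shows "a \<cdot>\<^sub>m (Q * D * Q\<^sup>T) - b \<cdot>\<^sub>m 1\<^sub>m n = Q * (a \<cdot>\<^sub>m D - b \<cdot>\<^sub>m 1\<^sub>m n) * Q\<^sup>T"
proof -
  have carr: "Q \<in> carrier_mat n n" "Q\<^sup>T \<in> carrier_mat n n" and QQ: "Q * Q\<^sup>T = 1\<^sub>m n"
    using Q by (auto simp: orthogonal_matrix_real_def)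
  have "Q * (a \<cdot>\<^sub>m D - b \<cdot>\<^sub>m 1\<^sub>m n) = Q * (a \<cdot>\<^sub>m D) - Q * (b \<cdot>\<^sub>m 1\<^sub>m n)"
    by (rule mult_minus_distrib_mat) (use carr D in auto)
  also have "\<dots> = a \<cdot>\<^sub>m (Q * D) - b \<cdot>\<^sub>m Q"
    using carr D by (simp add: mult_smult_distrib[of _ n n _ n])
  also have "\<dots> * Q\<^sup>T = a \<cdot>\<^sub>m (Q * D) * Q\<^sup>T - b \<cdot>\<^sub>m Q * Q\<^sup>T"
    by (rule minus_mult_distrib_mat) (use carr D in auto)
  \<comment> \<open>Orthogonality keeps the identity term fixed under the conjugation.\<close>
  also have "\<dots> = a \<cdot>\<^sub>m (Q * D * Q\<^sup>T) - b \<cdot>\<^sub>m 1\<^sub>m n"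
    using carr D by (simp add: mult_smult_assoc_mat[of _ n n _ n] QQ del: assoc_mult_mat)
  finally show ?thesis ..
qed

text \<open>All four blocks are conjugated by the same \<open>Q\<close>: the zero and identity
  blocks are invariant, and the lower blocks are affine in \<open>Q * D * Q\<^sup>T\<close>.\<close>

lemma similar_A_mat_diagonal_blocks:
  assumes Q: "orthogonal_matrix_real n Q" and D: "D \<in> carrier_mat n n"
  shows "similar_mat_wit (A_mat n \<alpha> \<beta> \<gamma> \<delta> (Q * D * Q\<^sup>T)) (A_mat n \<alpha> \<beta> \<gamma> \<delta> D)
    (four_block_mat Q (0\<^sub>m n n) (0\<^sub>m n n) Q) (four_block_mat (Q\<^sup>T) (0\<^sub>m n n) (0\<^sub>m n n) (Q\<^sup>T))"
proof -
  have carr: "Q \<in> carrier_mat n n" "Q\<^sup>T \<in> carrier_mat n n"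
    and QQ: "Q * Q\<^sup>T = 1\<^sub>m n" "Q\<^sup>T * Q = 1\<^sub>m n"
    using Q by (auto simp: orthogonal_matrix_real_def)
  have wit: "similar_mat_wit (Q * X * Q\<^sup>T) X Q (Q\<^sup>T)" if "X \<in> carrier_mat n n" for X
    using that carr by (intro similar_mat_witI[OF QQ]) auto
  have zero: "similar_mat_wit (0\<^sub>m n n) (0\<^sub>m n n) Q (Q\<^sup>T)"
    using wit[of "0\<^sub>m n n"] carr by simp
  have affine_carrier: "a \<cdot>\<^sub>m D - b \<cdot>\<^sub>m 1\<^sub>m n \<in> carrier_mat n n" for a b
    using D by auto
  show ?thesis
    unfolding A_mat_def orthogonal_conj_affine[OF Q D]
    by (rule similar_mat_wit_four_block[OF zero wit])
      (use carr QQ affine_carrier in auto)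
qed

lemma similar_A_mat_diag_G_mat:
  "similar_mat_wit (A_mat n \<alpha> \<beta> \<gamma> \<delta> (mat_diag n lam))
    (diag_block_mat (map (\<lambda>i. G_mat \<alpha> \<beta> \<gamma> \<delta> (lam i)) [0..<n])) (P_mat n) ((P_mat n)\<^sup>T)"
proof -
  let ?Gs = "map (\<lambda>i. G_mat \<alpha> \<beta> \<gamma> \<delta> (lam i)) [0..<n]"
  let ?X = "diag_block_mat ?Gs"
  have G: "G_mat \<alpha> \<beta> \<gamma> \<delta> l \<in> carrier_mat 2 2" for l
    by (rule carrier_matI) (simp_all add: G_mat_def mat_of_rows_list_def)
  have X: "?X \<in> carrier_mat (2 * n) (2 * n)"
    by (rule carrier_matI)
      (auto simp: dim_diag_block_mat comp_def carrier_matD[OF G] sum_list_triv)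
  \<comment> \<open>With diagonal blocks, an entry of \<open>A_mat\<close> can be nonzero only if
    \<open>i\<close> and \<open>j\<close> agree modulo \<open>n\<close>. After the shuffle,
    \<open>div 2\<close> is this common residue, and \<open>mod 2\<close> tells the upper half from
    the lower one and so selects the entry of the 2 by 2 block.\<close>
  have entry: "?X $$ (interleave n i, interleave n j) = A_mat n \<alpha> \<beta> \<gamma> \<delta> (mat_diag n lam) $$ (i, j)"
    if "i < 2 * n" "j < 2 * n" for i j
  proof -
    have "interleave n i < length ?Gs * 2" "interleave n j < length ?Gs * 2"
      using that by (auto simp: interleave_def)
    from index_diag_block_mat_uniform[OF _ this] G
    have "?X $$ (interleave n i, interleave n j) =
      (if interleave n i div 2 = interleave n j div 2
       then (?Gs ! (interleave n i div 2)) $$ (interleave n i mod 2, interleave n j mod 2) else 0)"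
      by auto
    thus ?thesis using that
      by (auto simp: interleave_def A_mat_def G_mat_def mat_of_rows_list_def mat_diag_def)
  qed
  have "A_mat n \<alpha> \<beta> \<gamma> \<delta> (mat_diag n lam) =
    mat (2 * n) (2 * n) (\<lambda>(i, j). ?X $$ (interleave n i, interleave n j))"
    by (rule eq_matI) (simp_all add: entry, simp_all add: A_mat_def mat_diag_def)
  thus ?thesis
    using similar_mat_wit_permutation[OF bij_betw_interleave X P_mat_interleave] by simp
qed

theorem theorem2p5:
  fixes n :: nat and \<alpha> \<beta> \<gamma> \<delta> t :: real
    and S Q D :: "real mat" and lam :: "nat \<Rightarrow> real"
  assumes "n \<ge> 1"
    and "\<alpha> > 0" and "\<beta> \<ge> 0" and "\<gamma> \<ge> 0" and "\<delta> \<ge> 0"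
    and "S \<in> carrier_mat n n"
    and "orthogonal_matrix_real n Q"
    and "D = mat_diag n lam"
    and "S = Q * D * Q\<^sup>T"
    and "t > 0"
  shows "mat_exp (t \<cdot>\<^sub>m A_mat n \<alpha> \<beta> \<gamma> \<delta> S) =
    four_block_mat Q (0\<^sub>m n n) (0\<^sub>m n n) Q
    * P_mat n
    * diag_block_mat (map (\<lambda>i. mat_exp (t \<cdot>\<^sub>m G_mat \<alpha> \<beta> \<gamma> \<delta> (lam i))) [0..<n])
    * (P_mat n)\<^sup>T
    * four_block_mat (Q\<^sup>T) (0\<^sub>m n n) (0\<^sub>m n n) (Q\<^sup>T)"
proof -
  let ?G = "\<lambda>i. G_mat \<alpha> \<beta> \<gamma> \<delta> (lam i)"
  let ?U = "four_block_mat Q (0\<^sub>m n n) (0\<^sub>m n n) Q"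
  let ?V = "four_block_mat (Q\<^sup>T) (0\<^sub>m n n) (0\<^sub>m n n) (Q\<^sup>T)"
  have "similar_mat_wit (A_mat n \<alpha> \<beta> \<gamma> \<delta> S) (diag_block_mat (map ?G [0..<n]))
      (?U * P_mat n) ((P_mat n)\<^sup>T * ?V)"
    unfolding \<open>S = Q * D * Q\<^sup>T\<close> \<open>D = mat_diag n lam\<close>
    by (rule similar_mat_wit_trans[OF similar_A_mat_diagonal_blocks[OF assms(7)]
          similar_A_mat_diag_G_mat]) simp
  \<comment> \<open>Scaling keeps the similarity witnesses, so \<open>t\<close> enters only after
    the reduction.\<close>
  note wit = similar_mat_wit_smult[OF this, of t]
  have sq: "square_mat (t \<cdot>\<^sub>m ?G i)" for i
    by (simp add: G_mat_def mat_of_rows_list_def)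
  have exp: "mat_exp (t \<cdot>\<^sub>m diag_block_mat (map ?G [0..<n])) =
      diag_block_mat (map (\<lambda>i. mat_exp (t \<cdot>\<^sub>m ?G i)) [0..<n])" (is "_ = ?E")
    unfolding smult_diag_block_mat using sq by (subst mat_exp_diag_block) (auto simp: comp_def)
  have "A_mat n \<alpha> \<beta> \<gamma> \<delta> S \<in> carrier_mat (n + n) (n + n)"
    using assms(6) by (auto simp: A_mat_def)
  \<comment> \<open>The size of the block diagonal matrix is inherited from \<open>A_mat\<close>
    through the similarity.\<close>
  hence "?E \<in> carrier_mat (n + n) (n + n)"
    unfolding exp[symmetric]
    by (intro mat_exp_carrier similar_mat_witD2(5)[OF smult_carrier_mat wit])
  moreover have "?U \<in> carrier_mat (n + n) (n + n)" "?V \<in> carrier_mat (n + n) (n + n)"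
    using assms(7) by (auto simp: orthogonal_matrix_real_def)
  moreover have "P_mat n \<in> carrier_mat (n + n) (n + n)"
    by (simp add: P_mat_def mult_2)
  \<comment> \<open>The similarity brackets the outer factors in pairs; what remains is
    associativity.\<close>
  ultimately show ?thesis
    unfolding mat_exp_similar[OF wit] exp
    by (simp add: assoc_mult_mat[of _ "n + n" "n + n" _ "n + n" _ "n + n"])
qed

end
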